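(* For every $r\ge1$, $$\frac{\alpha^*(P_{r+1})}{\nu(P_{r+1})}\ge\frac52-\frac{30r+55+5(-1)^r}{2^{r+4}} .$$ Consequently, $$\liminf_{r\to\infty}\frac{\alpha^*(P_r)}{\nu(P_r)}\ge\frac52 .$$
   Context: All rectangles are closed and axis-parallel. For a finite rectangle family $\mathcal R$, $\nu(\mathcal R)$ is the maximum size of a pairwise disjoint subfamily, and $G(\mathcal R)$ is the intersection graph (vertices are the rectangles, edges join intersecting pairs). The clique relaxation value is $$\alpha^*(\mathcal R)=\alpha^*(G(\mathcal R))=\max\Big\{\sum_{v}x_v:\ x_v\ge 0,\ \sum_{v\in K}x_v\le 1\text{ for every clique }K\text{ of }G(\mathcal R)\Big\}.$$ Construction of $P_r$. Write $[q]=\{0,1,\dots,q-1\}$. Each $P_r$ is a finite rectangle family drawn in a square $[0,L]^2$ together with $q$ vertical marker lines $x=\xi_0,\dots,x=\xi_{q-1}$ and $q$ horizontal marker lines $y=\eta_0,\dots,y=\eta_{q-1}$ (in increasing order). Base: $P_0$ has $L=30$, $q=4$, $\xi=(3,11,19,27)$, $\eta=(3,11,21,27)$ and consists of the eight rectangles $T=[0,30]\times[26,28]$, $U_L=[0,16]\times[20,22]$, $U_R=[14,30]\times[20,22]$, $C_0=[0,8]\times[2,10]$, $C_1=[6,16]\times[8,14]$, $C_2=[14,24]\times[8,14]$, $C_3=[22,30]\times[2,12]$, $Q=[6,24]\times[0,4]$. Crossbar step: given $P$ with data $L,q,\xi,\eta$, put $M=L+1$, and for $R=[x_1,x_2]\times[y_1,y_2]\in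 P$ and $i,j\in[q]$ let $$H_i(R)=[Mx_1,Mx_2]\times[M\xi_i+y_1,M\xi_i+y_2],\qquad V_j(R)=[M\xi_j+y_1,M\xi_j+y_2]\times[Mx_1,Mx_2].$$ $C(P)$ is the family of all $H_i(R)$ and $V_j(R)$ with $R\in P$, $i,j\in[q]$. It is drawn in $[0,ML+L]^2$, with $q^2$ vertical markers $\xi'_{(j,t)}=M\xi_j+\eta_t$ and $q^2$ horizontal markers $\eta'_{(i,t)}=M\xi_i+\eta_t$, indexed by $[q]\times[q]$ and ordered lexicographically. Recursion: $P_{r+1}=C(P_r)$ for $r\ge0$. *)

theory Defs
  imports Complex_Main "HOL-Library.Extended_Real"
begin

text \<open>\<open>Rect x1 x2 y1 y2\<close> stands for the closed rectangle \<open>[x1, x2] \<times> [y1, y2]\<close>. All rectangles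
  below satisfy \<open>x1 < x2\<close> and \<open>y1 < y2\<close>, so distinct coordinates give distinct point sets.\<close>

datatype rect = Rect real real real real

fun region :: "rect \<Rightarrow> (real \<times> real) set" where
  "region (Rect x1 x2 y1 y2) = {x1..x2} \<times> {y1..y2}"

definition pairwise_disjoint :: "rect set \<Rightarrow> bool" where
  "pairwise_disjoint S \<longleftrightarrow> pairwise (\<lambda>A B. disjnt (region A) (region B)) S"

definition \<nu> :: "rect set \<Rightarrow> nat" where
  "\<nu> F = Max {card S | S. S \<subseteq> F \<and> pairwise_disjoint S}"

text \<open>A simple graph is a pair of its vertex set and its set of two-element edges.\<close>

type_synonym 'a graph = "'a set \<times> 'a set set"

definition clique :: "'a graph \<Rightarrow> 'a set \<Rightarrow> bool" where
  "clique G K \<longleftrightarrow> K \<subseteq> fst G \<and> (\<forall>u\<in>K. \<forall>v\<in>K. u \<noteq> v \<longrightarrow> {u, v} \<in> snd G)"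

definition clique_feasible :: "'a graph \<Rightarrow> ('a \<Rightarrow> real) \<Rightarrow> bool" where
  "clique_feasible G x \<longleftrightarrow>
     (\<forall>v\<in>fst G. 0 \<le> x v) \<and> (\<forall>K. clique G K \<longrightarrow> (\<Sum>v\<in>K. x v) \<le> 1)"

text \<open>For a finite graph the feasible weightings form a nonempty compact polytope in \<open>\<real>\<^sup>V\<close>, so the
  supremum is the maximum.\<close>

definition graph_alpha_star :: "'a graph \<Rightarrow> real" where
  "graph_alpha_star G = Sup {(\<Sum>v\<in>fst G. x v) | x. clique_feasible G x}"

definition intersection_graph :: "rect set \<Rightarrow> rect graph" where
  "intersection_graph F =
     (F, {{A, B} | A B. A \<in> F \<and> B \<in> F \<and> A \<noteq> B \<and> region A \<inter> region B \<noteq> {}})"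

definition alpha_star :: "rect set \<Rightarrow> real" where
  "alpha_star F = graph_alpha_star (intersection_graph F)"

text \<open>A family drawn in \<open>[0, side]\<^sup>2\<close> with vertical marker lines \<open>x = xi ! j\<close> and horizontal marker
  lines \<open>y = eta ! i\<close>. The two marker lists have the same length \<open>q\<close> in every drawing used.\<close>

record drawing =
  rects :: "rect set"
  side :: real
  xi :: "real list"
  eta :: "real list"

definition base :: drawing where
  "base = \<lparr>
     rects =
      {Rect 0 30 26 28,
       Rect 0 16 20 22,
       Rect 14 30 20 22,
       Rect 0 8 2 10,
       Rect 6 16 8 14,
       Rect 14 24 8 14,
       Rect 22 30 2 12,
       Rect 6 24 0 4},
     side = 30,
     xi = [3, 11, 19, 27],
     eta = [3, 11, 21, 27]\<rparr>"

definition num_markers :: "drawing \<Rightarrow> nat" where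
  "num_markers D = length (xi D)"

definition scale :: "drawing \<Rightarrow> real" where
  "scale D = side D + 1"

fun H :: "drawing \<Rightarrow> nat \<Rightarrow> rect \<Rightarrow> rect" where
  "H D i (Rect x1 x2 y1 y2) =
     Rect (scale D * x1) (scale D * x2) (scale D * xi D ! i + y1) (scale D * xi D ! i + y2)"

fun V :: "drawing \<Rightarrow> nat \<Rightarrow> rect \<Rightarrow> rect" where
  "V D j (Rect x1 x2 y1 y2) =
     Rect (scale D * xi D ! j + y1) (scale D * xi D ! j + y2) (scale D * x1) (scale D * x2)"

text \<open>The list comprehensions enumerate the pairs of markers in lexicographic order. The positions of
  both the vertical and the horizontal markers of the new drawing are built from \<open>xi\<close> in the coarse
  and \<open>eta\<close> in the fine coordinate.\<close>

definition crossbar :: "drawing \<Rightarrow> drawing" where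
  "crossbar D = \<lparr>
     rects = {H D i R | i R. i < num_markers D \<and> R \<in> rects D}
           \<union> {V D j R | j R. j < num_markers D \<and> R \<in> rects D},
     side = scale D * side D + side D,
     xi = [scale D * a + b. a \<leftarrow> xi D, b \<leftarrow> eta D],
     eta = [scale D * a + b. a \<leftarrow> xi D, b \<leftarrow> eta D]\<rparr>"

fun drawing_P :: "nat \<Rightarrow> drawing" where
  "drawing_P 0 = base"
| "drawing_P (Suc r) = crossbar (drawing_P r)"

definition P :: "nat \<Rightarrow> rect set" where
  "P r = rects (drawing_P r)"

end

theory Submission
  imports Defs
begin

text \<open>Write \<open>q\<^sub>r\<close> for the number of markers of the drawing of \<^term>\<open>P r\<close> in each direction. The proof
  compares both parameters with \<open>q\<^sub>r\<close>: \<open>\<nu>(P\<^sub>r) \<le> q\<^sub>r\<close> (lemma \<open>nu_P_le\<close>), while for \<open>r \<ge> 1\<close> the family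
  \<open>P\<^sub>r\<^sub>+\<^sub>1\<close> contains a triangle-free subfamily of at least \<open>(5 - 10 / 2\<^sup>r) q\<^sub>r\<^sub>+\<^sub>1\<close> rectangles. Weights
  \<open>1/2\<close> on a triangle-free subfamily satisfy all clique constraints, so \<open>\<alpha>\<^sup>*(P\<^sub>r\<^sub>+\<^sub>1)\<close> is at least
  \<open>(5/2 - 5/2\<^sup>r) q\<^sub>r\<^sub>+\<^sub>1\<close>. The ratio is then at least \<open>5/2 - 5/2\<^sup>r\<close>, and \<open>5/2\<^sup>r = 80/2\<^bsup>r+4\<^esup>\<close> is no
  larger than the error term of the theorem.

  Everything about a crossbar drawing follows from one geometric fact (\<open>meets_hor_ver\<close>): the
  horizontal copy of \<open>R\<close> at marker \<open>a\<close> meets the vertical copy of \<open>S\<close> at marker \<open>c\<close> exactly if the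
  vertical marker line at \<open>c\<close> hits \<open>R\<close> and the one at \<open>a\<close> hits \<open>S\<close>, both in the old drawing.

  For \<open>\<nu>\<close>, an independent subfamily never has more members than the marker lines of either direction
  that it hits. This passes from a drawing to its crossbar: a vertical line \<open>c\<close> of the old
  drawing that is hit by the horizontal copy at \<open>a\<close> forbids the vertical copy at \<open>c\<close> to hit the line
  \<open>a\<close>. So for each \<open>c\<close> the horizontal copies hitting \<open>c\<close> and the lines hit by the vertical copy at \<open>c\<close>
  number at most \<open>q\<^sub>r\<close> together, and as soon as one horizontal copy hits \<open>c\<close>, all \<open>q\<^sub>r\<close> new lines
  refining \<open>c\<close> are hit.

  For \<open>\<alpha>\<^sup>*\<close>, the five-cycle of the base family supplies the factor \<open>5/2\<close>. Its copies form in every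
  \<open>P\<^sub>n\<close> with \<open>n \<ge> 1\<close> a \<^emph>\<open>filler\<close> \<open>Z\<^sub>n\<close>: a triangle-free family of size \<open>5/4 q\<^sub>n\<close> that half of the
  vertical marker lines miss. The \<^emph>\<open>cores\<close> \<open>W\<^sub>n\<close> start from the empty family, and \<open>W\<^sub>n\<^sub>+\<^sub>1\<close> consists of
  all vertical copies of \<open>Z\<^sub>n\<close> together with the horizontal copies of \<open>W\<^sub>n\<close> at the markers that miss
  \<open>Z\<^sub>n\<close>. By the geometric fact the two parts do not meet at all, and the densities
  \<open>w\<^sub>n = |W\<^sub>n| / q\<^sub>n\<close> satisfy \<open>w\<^sub>n\<^sub>+\<^sub>1 = 5/4 + w\<^sub>n/2\<close>, whose fixed point is \<open>5/2\<close>. The cores have the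
  further property that a vertical marker line hits only disjoint members; therefore all
  horizontal and all vertical copies of \<open>W\<^sub>n\<close> together are still triangle-free, which
  doubles the density.\<close>

section \<open>Crossbar drawings in lexicographic coordinates\<close>

definition meets :: "rect \<Rightarrow> rect \<Rightarrow> bool" where
  "meets R S \<longleftrightarrow> region R \<inter> region S \<noteq> {}"

fun on_vertical :: "real \<Rightarrow> rect \<Rightarrow> bool" where
  "on_vertical a (Rect x1 x2 y1 y2) \<longleftrightarrow> x1 \<le> a \<and> a \<le> x2"

fun on_horizontal :: "real \<Rightarrow> rect \<Rightarrow> bool" where
  "on_horizontal b (Rect x1 x2 y1 y2) \<longleftrightarrow> y1 \<le> b \<and> b \<le> y2"

fun flip :: "rect \<Rightarrow> rect" where
  "flip (Rect x1 x2 y1 y2) = Rect y1 y2 x1 x2"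

fun hor :: "real \<Rightarrow> real \<Rightarrow> rect \<Rightarrow> rect" where
  "hor M a (Rect x1 x2 y1 y2) = Rect (M * x1) (M * x2) (M * a + y1) (M * a + y2)"

definition ver :: "real \<Rightarrow> real \<Rightarrow> rect \<Rightarrow> rect" where
  "ver M a R = flip (hor M a R)"

text \<open>The distance of at least 1 between markers and rectangle sides excludes tangencies. It is what
  makes every comparison of coordinates in a crossbar drawing lexicographic, and crossbar drawings
  inherit it.\<close>

fun placed :: "drawing \<Rightarrow> rect \<Rightarrow> bool" where
  "placed D (Rect x1 x2 y1 y2) \<longleftrightarrow>
     0 \<le> x1 \<and> x1 + 1 \<le> x2 \<and> x2 \<le> side D \<and> 0 \<le> y1 \<and> y1 + 1 \<le> y2 \<and> y2 \<le> side D \<and>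
     (\<forall>a\<in>set (xi D). 1 \<le> \<bar>a - x1\<bar> \<and> 1 \<le> \<bar>a - x2\<bar>) \<and>
     (\<forall>b\<in>set (eta D). 1 \<le> \<bar>b - y1\<bar> \<and> 1 \<le> \<bar>b - y2\<bar>)"

definition separated :: "real set \<Rightarrow> bool" where
  "separated A \<longleftrightarrow> (\<forall>a\<in>A. \<forall>b\<in>A. a \<noteq> b \<longrightarrow> 1 \<le> \<bar>a - b\<bar>)"

definition well_drawn :: "drawing \<Rightarrow> bool" where
  "well_drawn D \<longleftrightarrow>
     finite (rects D) \<and> rects D \<noteq> {} \<and> (\<forall>R\<in>rects D. placed D R) \<and>
     set (xi D) \<noteq> {} \<and> card (set (xi D)) = card (set (eta D)) \<and>
     set (xi D) \<subseteq> {0..side D} \<and> set (eta D) \<subseteq> {0..side D} \<and>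
     separated (set (xi D)) \<and> separated (set (eta D))"

lemma meets_sym: "meets R S \<longleftrightarrow> meets S R"
  by (auto simp: meets_def)

lemma flip_flip [simp]: "flip (flip R) = R"
  by (cases R) auto

lemma meets_flip [simp]: "meets (flip R) (flip S) \<longleftrightarrow> meets R S"
  by (cases R; cases S) (auto simp: meets_def)

lemma on_vertical_flip [simp]: "on_vertical a (flip R) \<longleftrightarrow> on_horizontal a R"
  by (cases R) auto

lemma on_horizontal_flip [simp]: "on_horizontal a (flip R) \<longleftrightarrow> on_vertical a R"
  by (cases R) auto

lemma meets_Rect:
  assumes "x1 \<le> x2" "y1 \<le> y2" "u1 \<le> u2" "v1 \<le> v2"
  shows "meets (Rect x1 x2 y1 y2) (Rect u1 u2 v1 v2) \<longleftrightarrow>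
    x1 \<le> u2 \<and> u1 \<le> x2 \<and> y1 \<le> v2 \<and> v1 \<le> y2"
  using assms by (auto simp: meets_def Times_Int_Times)

text \<open>A coordinate \<open>(L + 1) * a + u\<close> with \<open>0 \<le> u \<le> L\<close> acts as a two-digit number with coarse digit \<open>a\<close>
  and fine digit \<open>u\<close>. The digits are real, but coarse digits that differ do so by at least 1.\<close>

lemma lex_less:
  fixes a c u v L :: real
  assumes "0 \<le> u" "0 \<le> v" "u \<le> L" "v \<le> L" "a + 1 \<le> c"
  shows "(L + 1) * a + u + 1 \<le> (L + 1) * c + v"
proof -
  have "(L + 1) * (a + 1) \<le> (L + 1) * c"
    using assms by (intro mult_left_mono) auto
  with assms show ?thesis by (simp add: algebra_simps)
qed

lemma lex_le:
  fixes a c u v L :: real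
  assumes "0 \<le> u" "0 \<le> v" "u \<le> L" "v \<le> L" "a = c \<or> 1 \<le> \<bar>a - c\<bar>"
  shows "(L + 1) * a + u \<le> (L + 1) * c + v \<longleftrightarrow> a < c \<or> a = c \<and> u \<le> v"
  using lex_less[of u v L a c] lex_less[of v u L c a] assms by (auto simp: abs_if split: if_splits)

lemma lex_separated:
  fixes a c u v L :: real
  assumes "0 \<le> u" "0 \<le> v" "u \<le> L" "v \<le> L" "1 \<le> \<bar>a - c\<bar> \<or> a = c \<and> 1 \<le> \<bar>u - v\<bar>"
  shows "1 \<le> \<bar>((L + 1) * a + u) - ((L + 1) * c + v)\<bar>"
  using lex_less[of u v L a c] lex_less[of v u L c a] assms by (auto simp: abs_if split: if_splits)

text \<open>The sides of a scaled rectangle are the numbers with fine digit 0. As they never have the coarse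
  digit of a marker, the fine digit of the other side of the comparison is irrelevant.\<close>

lemma lex_le_0_left:
  fixes a c v L :: real
  assumes "0 \<le> v" "v \<le> L" "1 \<le> \<bar>a - c\<bar>"
  shows "(L + 1) * a \<le> (L + 1) * c + v \<longleftrightarrow> a \<le> c"
  using lex_le[of 0 v L a c] assms by auto

lemma lex_le_0_right:
  fixes a c v L :: real
  assumes "0 \<le> v" "v \<le> L" "1 \<le> \<bar>a - c\<bar>"
  shows "(L + 1) * a + v \<le> (L + 1) * c \<longleftrightarrow> a \<le> c"
  using lex_le[of v 0 L a c] assms by auto

lemma well_drawn_placed: "well_drawn D \<Longrightarrow> R \<in> rects D \<Longrightarrow> placed D R"
  by (auto simp: well_drawn_def)

lemma well_drawn_finite: "well_drawn D \<Longrightarrow> finite (rects D)"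
  by (auto simp: well_drawn_def)

lemma well_drawn_xi: "well_drawn D \<Longrightarrow> a \<in> set (xi D) \<Longrightarrow> 0 \<le> a \<and> a \<le> side D"
  by (auto simp: well_drawn_def)

lemma well_drawn_eta: "well_drawn D \<Longrightarrow> a \<in> set (eta D) \<Longrightarrow> 0 \<le> a \<and> a \<le> side D"
  by (auto simp: well_drawn_def)

lemma well_drawn_xi_separated:
  "well_drawn D \<Longrightarrow> a \<in> set (xi D) \<Longrightarrow> b \<in> set (xi D) \<Longrightarrow> a = b \<or> 1 \<le> \<bar>a - b\<bar>"
  by (auto simp: well_drawn_def separated_def)

lemma well_drawn_eta_separated:
  "well_drawn D \<Longrightarrow> a \<in> set (eta D) \<Longrightarrow> b \<in> set (eta D) \<Longrightarrow> a = b \<or> 1 \<le> \<bar>a - b\<bar>"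
  by (auto simp: well_drawn_def separated_def)

lemma rects_crossbar:
  "rects (crossbar D) = (\<Union>a\<in>set (xi D). hor (scale D) a ` rects D)
     \<union> (\<Union>a\<in>set (xi D). ver (scale D) a ` rects D)"
proof -
  have h: "H D i R = hor (scale D) (xi D ! i) R" and v: "V D i R = ver (scale D) (xi D ! i) R" for i R
    by (cases R; simp add: ver_def)+
  show ?thesis
    by (auto simp: crossbar_def num_markers_def h v set_conv_nth)
qed

lemma xi_crossbar:
  "set (xi (crossbar D)) = (\<lambda>(a, b). scale D * a + b) ` (set (xi D) \<times> set (eta D))"
  by (force simp: crossbar_def)

lemma eta_crossbar: "eta (crossbar D) = xi (crossbar D)"
  by (simp add: crossbar_def)

lemma meets_hor_hor:
  assumes D: "well_drawn D" and "R \<in> rects D" "S \<in> rects D" "a \<in> set (xi D)" "c \<in> set (xi D)"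
  shows "meets (hor (scale D) a R) (hor (scale D) c S) \<longleftrightarrow> a = c \<and> meets R S"
proof (cases R, cases S)
  fix x1 x2 y1 y2 u1 u2 v1 v2
  assume R: "R = Rect x1 x2 y1 y2" and S: "S = Rect u1 u2 v1 v2"
  have p: "placed D R" "placed D S" using assms well_drawn_placed by auto
  have M: "scale D > 0" using well_drawn_xi[OF D assms(4)] by (simp add: scale_def)
  have sep: "a = c \<or> 1 \<le> \<bar>a - c\<bar>" "c = a \<or> 1 \<le> \<bar>c - a\<bar>"
    using well_drawn_xi_separated D assms by auto
  show ?thesis
    using p M lex_le[of y1 v2 "side D" a c] lex_le[of v1 y2 "side D" c a] sep
    by (auto simp: R S meets_Rect scale_def)
qed

lemma meets_ver_ver:
  assumes "well_drawn D" "R \<in> rects D" "S \<in> rects D" "a \<in> set (xi D)" "c \<in> set (xi D)"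
  shows "meets (ver (scale D) a R) (ver (scale D) c S) \<longleftrightarrow> a = c \<and> meets R S"
  using meets_hor_hor[OF assms] by (simp add: ver_def)

text \<open>The horizontal copy is so long, and the vertical copy so thin, that in each of the two directions the
  copies overlap just if a marker line crosses the original rectangle.\<close>

lemma meets_hor_ver:
  assumes D: "well_drawn D" and "R \<in> rects D" "S \<in> rects D" "a \<in> set (xi D)" "c \<in> set (xi D)"
  shows "meets (hor (scale D) a R) (ver (scale D) c S) \<longleftrightarrow> on_vertical c R \<and> on_vertical a S"
proof (cases R, cases S)
  fix x1 x2 y1 y2 u1 u2 v1 v2
  assume R: "R = Rect x1 x2 y1 y2" and S: "S = Rect u1 u2 v1 v2"
  have p: "placed D R" "placed D S" using assms well_drawn_placed by auto
  have M: "scale D > 0" using well_drawn_xi[OF D assms(4)] by (simp add: scale_def)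
  have s: "1 \<le> \<bar>x1 - c\<bar>" "1 \<le> \<bar>c - x2\<bar>" "1 \<le> \<bar>u1 - a\<bar>" "1 \<le> \<bar>a - u2\<bar>"
    using p assms by (auto simp: R S abs_minus_commute)
  show ?thesis
    using p M s lex_le_0_left[of v2 "side D" x1 c] lex_le_0_right[of v1 "side D" c x2]
      lex_le_0_left[of y2 "side D" u1 a] lex_le_0_right[of y1 "side D" a u2]
    by (auto simp: R S meets_Rect scale_def ver_def)
qed

text \<open>A marker of the crossbar drawing has a coarse digit \<open>a\<close> and a fine digit \<open>b\<close>. Lines across the copies
  see only \<open>a\<close>; lines along the copies must lie in the strip of the copy, and then see only \<open>b\<close>.\<close>

lemma on_vertical_hor:
  assumes D: "well_drawn D" and "R \<in> rects D" "a \<in> set (xi D)" "b \<in> set (eta D)"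
  shows "on_vertical (scale D * a + b) (hor (scale D) c R) \<longleftrightarrow> on_vertical a R"
proof (cases R)
  fix x1 x2 y1 y2
  assume R: "R = Rect x1 x2 y1 y2"
  have p: "placed D R" using assms well_drawn_placed by auto
  have s: "1 \<le> \<bar>x1 - a\<bar>" "1 \<le> \<bar>a - x2\<bar>"
    using p assms by (auto simp: R abs_minus_commute)
  show ?thesis
    using p s lex_le_0_left[of b "side D" x1 a] lex_le_0_right[of b "side D" a x2]
      well_drawn_eta[OF D assms(4)]
    by (auto simp: R scale_def)
qed

lemma on_horizontal_hor:
  assumes D: "well_drawn D" and "R \<in> rects D" "a \<in> set (xi D)" "b \<in> set (eta D)" "c \<in> set (xi D)"
  shows "on_horizontal (scale D * a + b) (hor (scale D) c R) \<longleftrightarrow> a = c \<and> on_horizontal b R"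
proof (cases R)
  fix x1 x2 y1 y2
  assume R: "R = Rect x1 x2 y1 y2"
  have p: "placed D R" using assms well_drawn_placed by auto
  have s: "a = c \<or> 1 \<le> \<bar>a - c\<bar>" "c = a \<or> 1 \<le> \<bar>c - a\<bar>"
    using well_drawn_xi_separated D assms by auto
  show ?thesis
    using p s lex_le[of y1 b "side D" c a] lex_le[of b y2 "side D" a c] well_drawn_eta[OF D assms(4)]
    by (auto simp: R scale_def)
qed

lemma on_horizontal_ver:
  assumes "well_drawn D" "R \<in> rects D" "a \<in> set (xi D)" "b \<in> set (eta D)"
  shows "on_horizontal (scale D * a + b) (ver (scale D) c R) \<longleftrightarrow> on_vertical a R"
  using on_vertical_hor[OF assms] by (simp add: ver_def)

lemma on_vertical_ver:
  assumes "well_drawn D" "R \<in> rects D" "a \<in> set (xi D)" "b \<in> set (eta D)" "c \<in> set (xi D)"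
  shows "on_vertical (scale D * a + b) (ver (scale D) c R) \<longleftrightarrow> a = c \<and> on_horizontal b R"
  using on_horizontal_hor[OF assms] by (simp add: ver_def)

lemma inj_hor:
  assumes D: "well_drawn D"
  shows "inj_on (\<lambda>(a, R). hor (scale D) a R) (set (xi D) \<times> rects D)"
proof (rule inj_onI, clarify)
  fix a R c S
  assume "a \<in> set (xi D)" "c \<in> set (xi D)" "R \<in> rects D" "S \<in> rects D"
    and eq: "hor (scale D) a R = hor (scale D) c S"
  obtain x1 x2 y1 y2 where R: "R = Rect x1 x2 y1 y2" by (cases R) auto
  have p: "placed D R" using D \<open>R \<in> rects D\<close> well_drawn_placed by blast
  have "meets (hor (scale D) a R) (hor (scale D) a R)" "scale D > 0"
    using meets_hor_hor[OF D \<open>R \<in> rects D\<close> \<open>R \<in> rects D\<close> \<open>a \<in> set (xi D)\<close> \<open>a \<in> set (xi D)\<close>] p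
    by (auto simp: R meets_Rect scale_def)
  then have "a = c" "scale D > 0"
    using meets_hor_hor[OF D \<open>R \<in> rects D\<close> \<open>S \<in> rects D\<close> \<open>a \<in> set (xi D)\<close> \<open>c \<in> set (xi D)\<close>] eq
    by auto
  with eq show "a = c \<and> R = S" by (cases S) (auto simp: R)
qed

lemma inj_ver:
  assumes D: "well_drawn D"
  shows "inj_on (\<lambda>(a, R). ver (scale D) a R) (set (xi D) \<times> rects D)"
  using inj_hor[OF D] by (auto simp: inj_on_def ver_def) (metis flip_flip)+

text \<open>A horizontal copy is at least \<^term>\<open>scale D\<close> wide, whereas a vertical copy is at most
  \<^term>\<open>side D\<close> wide.\<close>

lemma hor_neq_ver:
  assumes D: "well_drawn D" and "R \<in> rects D" "S \<in> rects D"
  shows "hor (scale D) a R \<noteq> ver (scale D) c S"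
proof
  assume eq: "hor (scale D) a R = ver (scale D) c S"
  obtain x1 x2 y1 y2 where R: "R = Rect x1 x2 y1 y2" by (cases R) auto
  obtain u1 u2 v1 v2 where S: "S = Rect u1 u2 v1 v2" by (cases S) auto
  have p: "placed D R" "placed D S" using assms well_drawn_placed by auto
  have "scale D * 1 \<le> scale D * (x2 - x1)"
    using p by (intro mult_left_mono) (auto simp: R scale_def)
  also have "\<dots> = v2 - v1" using eq by (auto simp: R S ver_def algebra_simps)
  also have "\<dots> \<le> side D" using p by (auto simp: S)
  finally show False by (simp add: scale_def)
qed

lemma inj_lex:
  assumes D: "well_drawn D"
  shows "inj_on (\<lambda>(a, b). scale D * a + b) (set (xi D) \<times> set (eta D))"
proof (rule inj_onI, clarify)
  fix a b c d
  assume m: "a \<in> set (xi D)" "c \<in> set (xi D)" "b \<in> set (eta D)" "d \<in> set (eta D)"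
    and eq: "scale D * a + b = scale D * c + d"
  have "a = c \<or> 1 \<le> \<bar>a - c\<bar>" using well_drawn_xi_separated D m by auto
  then have "a = c"
    using eq lex_separated[of b d "side D" a c] well_drawn_eta[OF D] m by (auto simp: scale_def)
  with eq show "a = c \<and> b = d" by auto
qed

lemma card_xi_crossbar:
  assumes "well_drawn D"
  shows "card (set (xi (crossbar D))) = card (set (xi D)) * card (set (eta D))"
  unfolding xi_crossbar using inj_lex[OF assms] by (simp add: card_image card_cartesian_product)

lemma placed_hor:
  assumes D: "well_drawn D" and "R \<in> rects D" "a \<in> set (xi D)"
  shows "placed (crossbar D) (hor (scale D) a R)"
proof (cases R)
  fix x1 x2 y1 y2
  assume R: "R = Rect x1 x2 y1 y2"
  define M where "M = scale D"
  have M_eq: "M = side D + 1" by (simp add: M_def scale_def)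
  have p: "0 \<le> x1" "x1 + 1 \<le> x2" "x2 \<le> side D" "0 \<le> y1" "y1 + 1 \<le> y2" "y2 \<le> side D"
    "\<And>a. a \<in> set (xi D) \<Longrightarrow> 1 \<le> \<bar>a - x1\<bar> \<and> 1 \<le> \<bar>a - x2\<bar>"
    "\<And>b. b \<in> set (eta D) \<Longrightarrow> 1 \<le> \<bar>b - y1\<bar> \<and> 1 \<le> \<bar>b - y2\<bar>"
    using well_drawn_placed[OF D \<open>R \<in> rects D\<close>] by (auto simp: R)
  have a: "0 \<le> a" "a \<le> side D" using well_drawn_xi D assms by auto
  have M1: "M \<ge> 1" using a by (simp add: M_eq)
  have "M * (x1 + 1) \<le> M * x2" "M * x2 \<le> M * side D" "M * a \<le> M * side D" "0 \<le> M * x1" "0 \<le> M * a"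
    using p a M1 by (auto intro: mult_left_mono)
  then have bounds: "M * x1 + 1 \<le> M * x2" "M * x2 \<le> M * side D + side D"
    "0 \<le> M * a + y1" "M * a + y2 \<le> M * side D + side D" "0 \<le> M * x1"
    using M1 p(1-6) a unfolding distrib_left by linarith+
  have sx: "1 \<le> \<bar>(M * c + b) - M * x1\<bar> \<and> 1 \<le> \<bar>(M * c + b) - M * x2\<bar>"
    if "c \<in> set (xi D)" "b \<in> set (eta D)" for b c
    using lex_separated[of b 0 "side D" c x1] lex_separated[of b 0 "side D" c x2] p(7)[OF that(1)]
      well_drawn_eta[OF D that(2)] by (auto simp: M_eq)
  have sy: "1 \<le> \<bar>(M * c + b) - (M * a + y1)\<bar> \<and> 1 \<le> \<bar>(M * c + b) - (M * a + y2)\<bar>"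
    if "c \<in> set (xi D)" "b \<in> set (eta D)" for b c
    using lex_separated[of b y1 "side D" c a] lex_separated[of b y2 "side D" c a] p(1-6) p(8)[OF that(2)]
      well_drawn_eta[OF D that(2)] well_drawn_xi_separated[OF D that(1) assms(3)]
    by (auto simp: M_eq)
  show ?thesis
    using bounds sx sy p
    by (auto simp: R eta_crossbar xi_crossbar simp flip: M_def) (auto simp: crossbar_def simp flip: M_def)
qed

lemma placed_flip: "set (xi D) = set (eta D) \<Longrightarrow> placed D (flip R) \<longleftrightarrow> placed D R"
  by (cases R) auto

lemma well_drawn_crossbar:
  assumes D: "well_drawn D"
  shows "well_drawn (crossbar D)"
proof -
  let ?M = "scale D"
  have sep: "separated (set (xi (crossbar D)))"
    unfolding separated_def
  proof (intro ballI impI)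
    fix p q assume pq: "p \<in> set (xi (crossbar D))" "q \<in> set (xi (crossbar D))" "p \<noteq> q"
    then obtain a b c d where e: "p = ?M * a + b" "q = ?M * c + d"
      and m: "a \<in> set (xi D)" "c \<in> set (xi D)" "b \<in> set (eta D)" "d \<in> set (eta D)"
      by (auto simp: xi_crossbar)
    show "1 \<le> \<bar>p - q\<bar>"
      using lex_separated[of b d "side D" a c] well_drawn_eta[OF D] m pq(3) 
        well_drawn_xi_separated[OF D m(1,2)] well_drawn_eta_separated[OF D m(3,4)]
      by (auto simp: e scale_def)
  qed
  have range: "set (xi (crossbar D)) \<subseteq> {0..side (crossbar D)}"
  proof
    fix p assume "p \<in> set (xi (crossbar D))"
    then obtain a b where e: "p = ?M * a + b" and m: "a \<in> set (xi D)" "b \<in> set (eta D)"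
      by (auto simp: xi_crossbar)
    have "0 \<le> ?M * a" "?M * a \<le> ?M * side D"
      using well_drawn_xi[OF D m(1)] by (auto simp: scale_def intro: mult_left_mono)
    with well_drawn_eta[OF D m(2)] show "p \<in> {0..side (crossbar D)}"
      by (auto simp: e crossbar_def)
  qed
  have "placed (crossbar D) R" if "R \<in> rects (crossbar D)" for R
    using that placed_hor[OF D] placed_flip[of "crossbar D"] by (auto simp: rects_crossbar ver_def eta_crossbar)
  moreover have "rects (crossbar D) \<noteq> {}" "set (xi (crossbar D)) \<noteq> {}"
    using D by (auto simp: well_drawn_def rects_crossbar xi_crossbar)
  moreover have "finite (rects (crossbar D))"
    using D by (auto simp: well_drawn_def rects_crossbar)
  ultimately show ?thesis
    using sep range by (simp add: well_drawn_def eta_crossbar)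
qed

lemma well_drawn_base: "well_drawn base"
  by (auto simp: well_drawn_def base_def separated_def)

lemma well_drawn_P: "well_drawn (drawing_P r)"
  by (induction r) (auto simp: well_drawn_base well_drawn_crossbar)

section \<open>Independent subfamilies\<close>

definition vertical_hits :: "drawing \<Rightarrow> rect set \<Rightarrow> real set" where
  "vertical_hits D I = {a \<in> set (xi D). \<exists>R\<in>I. on_vertical a R}"

definition horizontal_hits :: "drawing \<Rightarrow> rect set \<Rightarrow> real set" where
  "horizontal_hits D I = {b \<in> set (eta D). \<exists>R\<in>I. on_horizontal b R}"

text \<open>The induction invariant for the bound on \<^term>\<open>\<nu>\<close>. Both directions are needed: in a crossbar drawing
  the fine digits of the vertical markers come from the old horizontal ones.\<close>

definition hits_bound :: "drawing \<Rightarrow> bool" where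
  "hits_bound D \<longleftrightarrow> (\<forall>I\<subseteq>rects D. pairwise_disjoint I \<longrightarrow>
     card I \<le> card (vertical_hits D I) \<and> card I \<le> card (horizontal_hits D I))"

lemma pairwise_disjoint_iff:
  "pairwise_disjoint I \<longleftrightarrow> (\<forall>R\<in>I. \<forall>S\<in>I. R \<noteq> S \<longrightarrow> \<not> meets R S)"
  by (auto simp: pairwise_disjoint_def pairwise_def disjnt_def meets_def)

text \<open>Let \<open>A a\<close> and \<open>B a\<close> be the parts of \<open>I\<close> in the horizontal and the vertical copy at \<open>a\<close>. The sizes of the
  \<open>A a\<close> are bounded by the vertical lines that they hit, and these are counted by the line \<open>c\<close>
  instead of by \<open>a\<close>. It then suffices to compare, for each \<open>c\<close>, the number of \<open>a\<close> whose \<open>A a\<close> hits \<open>c\<close>,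
  plus the size of \<open>B c\<close>, with the size of the set \<open>N c\<close> of fine digits of those new markers with coarse
  digit \<open>c\<close> whose lines hit \<open>I\<close>.\<close>

lemma card_vertical_hits_crossbar:
  assumes D: "well_drawn D" and bound: "hits_bound D"
    and I: "I \<subseteq> rects (crossbar D)" "pairwise_disjoint I"
  shows "card I \<le> card (vertical_hits (crossbar D) I)"
proof -
  let ?M = "scale D" and ?X = "set (xi D)" and ?Y = "set (eta D)"
  define A where "A a = {R \<in> rects D. hor ?M a R \<in> I}" for a
  define B where "B a = {R \<in> rects D. ver ?M a R \<in> I}" for a
  define N where "N c = {b \<in> ?Y. \<exists>R\<in>I. on_vertical (?M * c + b) R}" for c
  have fin: "finite (A a)" "finite (B a)" for a
    using well_drawn_finite[OF D] by (auto simp: A_def B_def)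
  have "pairwise_disjoint (A a)" "pairwise_disjoint (B a)" if a: "a \<in> ?X" for a
  proof -
    have "hor ?M a R \<noteq> hor ?M a S" "ver ?M a R \<noteq> ver ?M a S"
      if "R \<in> rects D" "S \<in> rects D" "R \<noteq> S" for R S
      using that a inj_onD[OF inj_hor[OF D], of "(a, R)" "(a, S)"]
        inj_onD[OF inj_ver[OF D], of "(a, R)" "(a, S)"] by auto
    then show "pairwise_disjoint (A a)" "pairwise_disjoint (B a)"
      using I(2) meets_hor_hor[OF D _ _ a a] meets_ver_ver[OF D _ _ a a]
      unfolding pairwise_disjoint_iff A_def B_def by blast+
  qed
  then have A_le: "card (A a) \<le> card (vertical_hits D (A a))"
    and B_le: "card (B a) \<le> card (vertical_hits D (B a))" "card (B a) \<le> card (horizontal_hits D (B a))"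
    if "a \<in> ?X" for a
    using bound that by (auto simp: hits_bound_def A_def B_def)
  have column: "card {a \<in> ?X. c \<in> vertical_hits D (A a)} + card (B c) \<le> card (N c)"
    if c: "c \<in> ?X" for c
  proof (cases "{a \<in> ?X. c \<in> vertical_hits D (A a)} = {}")
    case True
    \<comment> \<open>Only the vertical copy at \<open>c\<close> contributes; its lines with coarse digit \<open>c\<close> are the old
      horizontal ones.\<close>
    have "horizontal_hits D (B c) \<subseteq> N c"
      using on_vertical_ver[OF D _ c _ c] unfolding horizontal_hits_def N_def B_def by blast
    then have "card (horizontal_hits D (B c)) \<le> card (N c)"
      by (intro card_mono) (auto simp: N_def)
    then have "card (B c) \<le> card (N c)" using B_le(2)[OF c] by (rule order_trans[rotated])
    then show ?thesis unfolding True by simp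
  next
    case False
    then obtain a R where a: "a \<in> ?X" and R: "R \<in> A a" "on_vertical c R"
      by (auto simp: vertical_hits_def)
    \<comment> \<open>A horizontal copy hit at \<open>c\<close> is hit by all new lines with coarse digit \<open>c\<close>. Copies that cross
      at \<open>(a, c)\<close> exclude each other, so the two counts together fit into the old markers.\<close>
    have "N c = ?Y"
      using on_vertical_hor[OF D _ c] R unfolding N_def A_def by blast
    moreover have "{a \<in> ?X. c \<in> vertical_hits D (A a)} \<inter> vertical_hits D (B c) = {}"
    proof safe
      fix a assume "a \<in> ?X" "c \<in> vertical_hits D (A a)" "a \<in> vertical_hits D (B c)"
      then obtain R S where "R \<in> A a" "on_vertical c R" "S \<in> B c" "on_vertical a S"
        by (auto simp: vertical_hits_def)
      with \<open>a \<in> ?X\<close> c I(2) hor_neq_ver[OF D, of R S a c] meets_hor_ver[OF D, of R S a c]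
      show "a \<in> {}" by (auto simp: pairwise_disjoint_iff A_def B_def)
    qed
    then have "card {a \<in> ?X. c \<in> vertical_hits D (A a)} + card (vertical_hits D (B c))
        = card ({a \<in> ?X. c \<in> vertical_hits D (A a)} \<union> vertical_hits D (B c))"
      by (subst card_Un_disjoint) (auto simp: vertical_hits_def)
    then have "card {a \<in> ?X. c \<in> vertical_hits D (A a)} + card (vertical_hits D (B c)) \<le> card ?X"
      by (simp, intro card_mono) (auto simp: vertical_hits_def)
    moreover have "card ?X = card ?Y" using D by (simp add: well_drawn_def)
    ultimately show ?thesis using B_le(1)[OF c] by simp
  qed
  have "I \<subseteq> (\<Union>a\<in>?X. hor ?M a ` A a) \<union> (\<Union>a\<in>?X. ver ?M a ` B a)"
  proof
    fix R assume R: "R \<in> I"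
    then have "R \<in> rects (crossbar D)" using I(1) by blast
    then show "R \<in> (\<Union>a\<in>?X. hor ?M a ` A a) \<union> (\<Union>a\<in>?X. ver ?M a ` B a)"
      using R by (auto simp: rects_crossbar A_def B_def)
  qed
  then have "card I \<le> card ((\<Union>a\<in>?X. hor ?M a ` A a) \<union> (\<Union>a\<in>?X. ver ?M a ` B a))"
    by (intro card_mono) (auto simp: fin)
  also have "\<dots> \<le> card (\<Union>a\<in>?X. hor ?M a ` A a) + card (\<Union>a\<in>?X. ver ?M a ` B a)"
    by (rule card_Un_le)
  also have "\<dots> \<le> (\<Sum>a\<in>?X. card (hor ?M a ` A a)) + (\<Sum>a\<in>?X. card (ver ?M a ` B a))"
    by (intro add_mono card_UN_le) auto
  also have "\<dots> \<le> (\<Sum>a\<in>?X. card (vertical_hits D (A a))) + (\<Sum>a\<in>?X. card (B a))"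
    using order_trans[OF card_image_le[OF fin(1)] A_le] card_image_le[OF fin(2)]
    by (intro add_mono sum_mono) auto
  also have "(\<Sum>a\<in>?X. card (vertical_hits D (A a)))
      = (\<Sum>a\<in>?X. \<Sum>c\<in>?X. if c \<in> vertical_hits D (A a) then 1 else 0)"
    by (simp add: sum.If_cases) (simp add: vertical_hits_def Int_def)
  also have "\<dots> = (\<Sum>c\<in>?X. \<Sum>a\<in>?X. if c \<in> vertical_hits D (A a) then 1 else 0)"
    by (rule sum.swap)
  also have "\<dots> = (\<Sum>c\<in>?X. card {a \<in> ?X. c \<in> vertical_hits D (A a)})"
    by (simp add: sum.If_cases Int_def)
  also have "\<dots> + (\<Sum>c\<in>?X. card (B c)) \<le> (\<Sum>c\<in>?X. card (N c))"
    using column by (simp add: sum.distrib[symmetric] sum_mono)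
  also have "\<dots> = card (Sigma ?X N)" by (simp add: N_def)
  also have "\<dots> = card ((\<lambda>(a, b). ?M * a + b) ` Sigma ?X N)"
    by (intro card_image[symmetric] inj_on_subset[OF inj_lex[OF D]]) (auto simp: N_def)
  also have "\<dots> \<le> card (vertical_hits (crossbar D) I)"
    by (intro card_mono) (auto simp: vertical_hits_def N_def xi_crossbar)
  finally show ?thesis .
qed

text \<open>A crossbar drawing is symmetric under the reflection \<^const>\<open>flip\<close>, so the vertical bound suffices.\<close>

lemma hits_bound_crossbar:
  assumes D: "well_drawn D" and bound: "hits_bound D"
  shows "hits_bound (crossbar D)"
  unfolding hits_bound_def
proof (intro allI impI conjI)
  fix I assume I: "I \<subseteq> rects (crossbar D)" "pairwise_disjoint I"
  show "card I \<le> card (vertical_hits (crossbar D) I)"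
    using card_vertical_hits_crossbar[OF assms I] .
  have "flip ` rects (crossbar D) = rects (crossbar D)"
    by (simp add: rects_crossbar image_Un image_UN image_image ver_def Un_commute)
  then have "flip ` I \<subseteq> rects (crossbar D)" using I(1) by blast
  moreover have "pairwise_disjoint (flip ` I)" using I(2) by (auto simp: pairwise_disjoint_iff)
  ultimately have "card (flip ` I) \<le> card (vertical_hits (crossbar D) (flip ` I))"
    using card_vertical_hits_crossbar[OF assms] by blast
  moreover have "card (flip ` I) = card I"
    by (intro card_image inj_onI) (metis flip_flip)
  moreover have "vertical_hits (crossbar D) (flip ` I) = horizontal_hits (crossbar D) I"
    by (simp add: vertical_hits_def horizontal_hits_def eta_crossbar)
  ultimately show "card I \<le> card (horizontal_hits (crossbar D) I)" by simp
qed

text \<open>The base case of the count. The letters stand for membership of the eight base rectangles in an independent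
  family; the right-hand sides list which of them each of the four marker lines hits.\<close>

lemma base_count:
  assumes "\<not> (ul \<and> ur)" "\<not> (c0 \<and> c1)" "\<not> (c1 \<and> c2)" "\<not> (c2 \<and> c3)" "\<not> (c3 \<and> q)" "\<not> (q \<and> c0)"
  shows "(of_bool t + (of_bool ul + (of_bool ur + (of_bool c0 + (of_bool c1 + (of_bool c2 + (of_bool c3 + of_bool q)))))) :: nat)
     \<le> of_bool (t \<or> ul \<or> c0) + (of_bool (t \<or> ul \<or> c1 \<or> q) + (of_bool (t \<or> ur \<or> c2 \<or> q) + of_bool (t \<or> ur \<or> c3)))"
   "(of_bool t + (of_bool ul + (of_bool ur + (of_bool c0 + (of_bool c1 + (of_bool c2 + (of_bool c3 + of_bool q)))))) :: nat)
     \<le> of_bool (c0 \<or> c3 \<or> q) + (of_bool (c1 \<or> c2 \<or> c3) + (of_bool (ul \<or> ur) + of_bool t))"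
  using assms by (auto simp: of_bool_def)

lemma hits_bound_base: "hits_bound base"
  unfolding hits_bound_def
proof (intro allI impI)
  fix I assume I: "I \<subseteq> rects base" "pairwise_disjoint I"
  let ?T = "Rect 0 30 26 28" and ?UL = "Rect 0 16 20 22" and ?UR = "Rect 14 30 20 22"
    and ?C0 = "Rect 0 8 2 10" and ?C1 = "Rect 6 16 8 14" and ?C2 = "Rect 14 24 8 14"
    and ?C3 = "Rect 22 30 2 12" and ?Q = "Rect 6 24 0 4"
  have disj: "R = S" if "meets R S" "R \<in> I" "S \<in> I" for R S
    using I(2) that by (auto simp: pairwise_disjoint_iff)
  have edges: "\<not> (?UL \<in> I \<and> ?UR \<in> I)" "\<not> (?C0 \<in> I \<and> ?C1 \<in> I)" "\<not> (?C1 \<in> I \<and> ?C2 \<in> I)"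
    "\<not> (?C2 \<in> I \<and> ?C3 \<in> I)" "\<not> (?C3 \<in> I \<and> ?Q \<in> I)" "\<not> (?Q \<in> I \<and> ?C0 \<in> I)"
    using disj[of ?UL ?UR] disj[of ?C0 ?C1] disj[of ?C1 ?C2] disj[of ?C2 ?C3] disj[of ?C3 ?Q] disj[of ?Q ?C0]
    by (auto simp: meets_Rect)
  have ex: "(\<exists>R\<in>I. p R) \<longleftrightarrow> (\<exists>R\<in>rects base. R \<in> I \<and> p R)" for p
    using I(1) by blast
  have "card I = (\<Sum>R\<in>rects base. of_bool (R \<in> I))"
    using I(1) well_drawn_finite[OF well_drawn_base] by (simp add: Int_absorb1)
  also have "\<dots> = of_bool (?T \<in> I) + (of_bool (?UL \<in> I) + (of_bool (?UR \<in> I) + (of_bool (?C0 \<in> I)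
      + (of_bool (?C1 \<in> I) + (of_bool (?C2 \<in> I) + (of_bool (?C3 \<in> I) + of_bool (?Q \<in> I)))))))"
    by (simp add: base_def)
  finally have card_I: "card I = \<dots>" .
  have "card (vertical_hits base I) = (\<Sum>a\<in>set (xi base). of_bool (a \<in> vertical_hits base I))"
    by (simp add: vertical_hits_def Int_def)
  also have "\<dots> = of_bool (3 \<in> vertical_hits base I) + (of_bool (11 \<in> vertical_hits base I)
      + (of_bool (19 \<in> vertical_hits base I) + of_bool (27 \<in> vertical_hits base I)))"
    by (simp add: base_def)
  finally have card_v: "card (vertical_hits base I) = \<dots>" .
  have v: "3 \<in> vertical_hits base I \<longleftrightarrow> ?T \<in> I \<or> ?UL \<in> I \<or> ?C0 \<in> I"
    "11 \<in> vertical_hits base I \<longleftrightarrow> ?T \<in> I \<or> ?UL \<in> I \<or> ?C1 \<in> I \<or> ?Q \<in> I"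
    "19 \<in> vertical_hits base I \<longleftrightarrow> ?T \<in> I \<or> ?UR \<in> I \<or> ?C2 \<in> I \<or> ?Q \<in> I"
    "27 \<in> vertical_hits base I \<longleftrightarrow> ?T \<in> I \<or> ?UR \<in> I \<or> ?C3 \<in> I"
    unfolding vertical_hits_def ex by (simp_all add: base_def)
  have "card (horizontal_hits base I) = (\<Sum>b\<in>set (eta base). of_bool (b \<in> horizontal_hits base I))"
    by (simp add: horizontal_hits_def Int_def)
  also have "\<dots> = of_bool (3 \<in> horizontal_hits base I) + (of_bool (11 \<in> horizontal_hits base I)
      + (of_bool (21 \<in> horizontal_hits base I) + of_bool (27 \<in> horizontal_hits base I)))"
    by (simp add: base_def)
  finally have card_h: "card (horizontal_hits base I) = \<dots>" .
  have h: "3 \<in> horizontal_hits base I \<longleftrightarrow> ?C0 \<in> I \<or> ?C3 \<in> I \<or> ?Q \<in> I"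
    "11 \<in> horizontal_hits base I \<longleftrightarrow> ?C1 \<in> I \<or> ?C2 \<in> I \<or> ?C3 \<in> I"
    "21 \<in> horizontal_hits base I \<longleftrightarrow> ?UL \<in> I \<or> ?UR \<in> I"
    "27 \<in> horizontal_hits base I \<longleftrightarrow> ?T \<in> I"
    unfolding horizontal_hits_def ex by (simp_all add: base_def)
  show "card I \<le> card (vertical_hits base I) \<and> card I \<le> card (horizontal_hits base I)"
    unfolding card_I card_v card_h v h using base_count[OF edges] by blast
qed

lemma nu_P_le: "\<nu> (P r) \<le> card (set (xi (drawing_P r)))"
proof -
  have "hits_bound (drawing_P r)"
    by (induction r) (auto simp: hits_bound_base hits_bound_crossbar well_drawn_P)
  moreover have "card (vertical_hits (drawing_P r) I) \<le> card (set (xi (drawing_P r)))" for I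
    by (intro card_mono) (auto simp: vertical_hits_def)
  ultimately have "card I \<le> card (set (xi (drawing_P r)))" if "I \<subseteq> P r" "pairwise_disjoint I" for I
    using that unfolding hits_bound_def P_def by (meson order_trans)
  moreover have "finite {card I |I. I \<subseteq> P r \<and> pairwise_disjoint I}"
    using well_drawn_finite[OF well_drawn_P] by (auto simp: P_def)
  moreover have "pairwise_disjoint {}" by (simp add: pairwise_disjoint_iff)
  ultimately show ?thesis
    unfolding \<nu>_def by (subst Max_le_iff) blast+
qed

lemma nu_P_pos: "0 < \<nu> (P r)"
proof -
  obtain R where R: "R \<in> P r" using well_drawn_P[of r] by (auto simp: well_drawn_def P_def)
  have "finite {card I |I. I \<subseteq> P r \<and> pairwise_disjoint I}"
    using well_drawn_finite[OF well_drawn_P] by (auto simp: P_def)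
  moreover have "card {R} \<in> {card I |I. I \<subseteq> P r \<and> pairwise_disjoint I}"
    using R by (intro CollectI exI[of _ "{R}"]) (auto simp: pairwise_disjoint_iff)
  ultimately have "card {R} \<le> \<nu> (P r)" unfolding \<nu>_def by (rule Max_ge)
  then show ?thesis by simp
qed

section \<open>Triangle-free subfamilies\<close>

definition triangle_free :: "rect set \<Rightarrow> bool" where
  "triangle_free W \<longleftrightarrow> (\<forall>R\<in>W. \<forall>S\<in>W. \<forall>T\<in>W.
     meets R S \<and> meets S T \<and> meets R T \<longrightarrow> R = S \<or> S = T \<or> R = T)"

text \<open>If two meeting rectangles lie on a common vertical line \<open>a\<close>, their horizontal copies at a marker both
  cross the vertical copies at \<open>a\<close> that this marker's line hits, and triangles arise in the crossbar drawing.\<close>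

definition vertically_independent :: "drawing \<Rightarrow> rect set \<Rightarrow> bool" where
  "vertically_independent D W \<longleftrightarrow> (\<forall>a\<in>set (xi D). \<forall>R\<in>W. \<forall>S\<in>W.
     on_vertical a R \<and> on_vertical a S \<and> meets R S \<longrightarrow> R = S)"

definition horizontally_independent :: "drawing \<Rightarrow> rect set \<Rightarrow> bool" where
  "horizontally_independent D W \<longleftrightarrow> (\<forall>b\<in>set (eta D). \<forall>R\<in>W. \<forall>S\<in>W.
     on_horizontal b R \<and> on_horizontal b S \<and> meets R S \<longrightarrow> R = S)"

definition missed_verticals :: "drawing \<Rightarrow> rect set \<Rightarrow> real set" where
  "missed_verticals D Z = {a \<in> set (xi D). \<forall>R\<in>Z. \<not> on_vertical a R}"

text \<open>The two marker directions enter differently: a filler is used in vertical copies, where the new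
  vertical lines see the old horizontal ones. Hence its independence concerns horizontal lines, whereas the
  vertical lines that miss it are the places left for further rectangles.\<close>

definition filler :: "drawing \<Rightarrow> rect set \<Rightarrow> bool" where
  "filler D Z \<longleftrightarrow> Z \<subseteq> rects D \<and> triangle_free Z \<and> horizontally_independent D Z \<and>
     4 * card Z = 5 * card (set (xi D)) \<and>
     2 * card (missed_verticals D Z) = card (set (xi D))"

definition rows :: "drawing \<Rightarrow> real set \<Rightarrow> rect set \<Rightarrow> rect set" where
  "rows D A W = (\<Union>a\<in>A. hor (scale D) a ` W)"

definition columns :: "drawing \<Rightarrow> real set \<Rightarrow> rect set \<Rightarrow> rect set" where
  "columns D A W = (\<Union>a\<in>A. ver (scale D) a ` W)"

lemma rows_columns_subset:
  assumes "A \<subseteq> set (xi D)" "W \<subseteq> rects D"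
  shows "rows D A W \<subseteq> rects (crossbar D)" "columns D A W \<subseteq> rects (crossbar D)"
proof -
  show "rows D A W \<subseteq> rects (crossbar D)"
    unfolding rows_def rects_crossbar using assms by (intro le_supI1 UN_mono image_mono)
  show "columns D A W \<subseteq> rects (crossbar D)"
    unfolding columns_def rects_crossbar using assms by (intro le_supI2 UN_mono image_mono)
qed

lemma card_rows:
  assumes "well_drawn D" "A \<subseteq> set (xi D)" "W \<subseteq> rects D"
  shows "card (rows D A W) = card A * card W"
proof -
  have "rows D A W = (\<lambda>(a, R). hor (scale D) a R) ` (A \<times> W)"
    by (auto simp: rows_def)
  moreover have "inj_on (\<lambda>(a, R). hor (scale D) a R) (A \<times> W)"
    using inj_on_subset[OF inj_hor[OF assms(1)]] assms by (meson Sigma_mono)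
  ultimately show ?thesis by (simp add: card_image card_cartesian_product)
qed

lemma card_columns:
  assumes "well_drawn D" "A \<subseteq> set (xi D)" "W \<subseteq> rects D"
  shows "card (columns D A W) = card A * card W"
proof -
  have "columns D A W = (\<lambda>(a, R). ver (scale D) a R) ` (A \<times> W)"
    by (auto simp: columns_def)
  moreover have "inj_on (\<lambda>(a, R). ver (scale D) a R) (A \<times> W)"
    using inj_on_subset[OF inj_ver[OF assms(1)]] assms by (meson Sigma_mono)
  ultimately show ?thesis by (simp add: card_image card_cartesian_product)
qed

lemma card_rows_Un_columns:
  assumes D: "well_drawn D" and "A \<subseteq> set (xi D)" "W \<subseteq> rects D" "B \<subseteq> set (xi D)" "Z \<subseteq> rects D"
  shows "card (rows D A W \<union> columns D B Z) = card A * card W + card B * card Z"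
proof -
  have "finite A" "finite B" "finite W" "finite Z"
    using assms well_drawn_finite[OF D] by (auto intro: finite_subset)
  moreover have "rows D A W \<inter> columns D B Z = {}"
    using hor_neq_ver[OF D] assms(3,5) by (auto simp: rows_def columns_def subset_iff)
  ultimately have "card (rows D A W \<union> columns D B Z) = card (rows D A W) + card (columns D B Z)"
    by (intro card_Un_disjoint) (auto simp: rows_def columns_def)
  with assms show ?thesis by (simp add: card_rows card_columns)
qed

lemma triangle_free_rows:
  assumes D: "well_drawn D" and "A \<subseteq> set (xi D)" "W \<subseteq> rects D" "triangle_free W"
  shows "triangle_free (rows D A W)"
  unfolding triangle_free_def
proof (intro ballI impI)
  fix R S T assume "R \<in> rows D A W" "S \<in> rows D A W" "T \<in> rows D A W"
    and m: "meets R S \<and> meets S T \<and> meets R T"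
  then obtain a b c R' S' T' where e: "R = hor (scale D) a R'" "S = hor (scale D) b S'" "T = hor (scale D) c T'"
    and i: "a \<in> A" "b \<in> A" "c \<in> A" "R' \<in> W" "S' \<in> W" "T' \<in> W"
    by (auto simp: rows_def)
  have "R' \<in> rects D" "S' \<in> rects D" "T' \<in> rects D" "a \<in> set (xi D)" "b \<in> set (xi D)" "c \<in> set (xi D)"
    using i assms(2,3) by auto
  with m have "a = b" "b = c" "meets R' S' \<and> meets S' T' \<and> meets R' T'"
    by (auto simp: e meets_hor_hor[OF D])
  with assms(4) i show "R = S \<or> S = T \<or> R = T"
    unfolding triangle_free_def e by blast
qed

lemma triangle_free_columns:
  assumes "well_drawn D" "A \<subseteq> set (xi D)" "W \<subseteq> rects D" "triangle_free W"
  shows "triangle_free (columns D A W)"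
proof -
  have "columns D A W = flip ` rows D A W"
    by (simp add: columns_def rows_def image_UN image_image ver_def)
  with triangle_free_rows[OF assms] show ?thesis
    unfolding triangle_free_def by auto
qed

text \<open>In a triangle of a union, two of the three members lie in the same part.\<close>

lemma triangle_free_UnI:
  assumes A: "triangle_free A" and B: "triangle_free B"
    and AAB: "\<And>R S T. R \<in> A \<Longrightarrow> S \<in> A \<Longrightarrow> T \<in> B \<Longrightarrow> meets R S \<Longrightarrow> meets R T \<Longrightarrow> meets S T \<Longrightarrow> R = S"
    and BBA: "\<And>R S T. R \<in> B \<Longrightarrow> S \<in> B \<Longrightarrow> T \<in> A \<Longrightarrow> meets R S \<Longrightarrow> meets R T \<Longrightarrow> meets S T \<Longrightarrow> R = S"
  shows "triangle_free (A \<union> B)"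
  unfolding triangle_free_def
proof (intro ballI impI)
  fix R S T assume i: "R \<in> A \<union> B" "S \<in> A \<union> B" "T \<in> A \<union> B"
    and "meets R S \<and> meets S T \<and> meets R T"
  then have m: "meets R S" "meets S R" "meets S T" "meets T S" "meets R T" "meets T R"
    using meets_sym by auto
  from i consider "R \<in> A" "S \<in> A" "T \<in> A" | "R \<in> B" "S \<in> B" "T \<in> B"
    | "R \<in> A" "S \<in> A" "T \<in> B" | "R \<in> A" "S \<in> B" "T \<in> A" | "R \<in> B" "S \<in> A" "T \<in> A"
    | "R \<in> B" "S \<in> B" "T \<in> A" | "R \<in> B" "S \<in> A" "T \<in> B" | "R \<in> A" "S \<in> B" "T \<in> B"
    by blast
  then show "R = S \<or> S = T \<or> R = T"
  proof cases
    case 1 with A m show ?thesis unfolding triangle_free_def by blast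
  next
    case 2 with B m show ?thesis unfolding triangle_free_def by blast
  qed (use m AAB BBA in blast)+
qed

lemma horizontally_independent_rows:
  assumes D: "well_drawn D" and W: "W \<subseteq> rects D" "horizontally_independent D W"
  shows "horizontally_independent (crossbar D) (rows D (set (xi D)) W)"
  unfolding horizontally_independent_def
proof (intro ballI impI)
  fix p R S assume "p \<in> set (eta (crossbar D))" "R \<in> rows D (set (xi D)) W" "S \<in> rows D (set (xi D)) W"
    and h: "on_horizontal p R \<and> on_horizontal p S \<and> meets R S"
  then obtain a b c d R' S' where e: "p = scale D * a + b" "R = hor (scale D) c R'" "S = hor (scale D) d S'"
    and i: "a \<in> set (xi D)" "b \<in> set (eta D)" "c \<in> set (xi D)" "d \<in> set (xi D)" "R' \<in> W" "S' \<in> W"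
    by (auto simp: rows_def eta_crossbar xi_crossbar)
  have "R' \<in> rects D" "S' \<in> rects D" using W i by auto
  with h i have "c = d" "on_horizontal b R'" "on_horizontal b S'" "meets R' S'"
    unfolding e using on_horizontal_hor[OF D] meets_hor_hor[OF D] by blast+
  with W i show "R = S" unfolding horizontally_independent_def e by blast
qed

lemma horizontally_independent_columns:
  assumes D: "well_drawn D" and W: "W \<subseteq> rects D" "vertically_independent D W"
  shows "horizontally_independent (crossbar D) (columns D (set (xi D)) W)"
  unfolding horizontally_independent_def
proof (intro ballI impI)
  fix p R S assume "p \<in> set (eta (crossbar D))" "R \<in> columns D (set (xi D)) W" "S \<in> columns D (set (xi D)) W"
    and h: "on_horizontal p R \<and> on_horizontal p S \<and> meets R S"
  then obtain a b c d R' S' where e: "p = scale D * a + b" "R = ver (scale D) c R'" "S = ver (scale D) d S'"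
    and i: "a \<in> set (xi D)" "b \<in> set (eta D)" "c \<in> set (xi D)" "d \<in> set (xi D)" "R' \<in> W" "S' \<in> W"
    by (auto simp: columns_def eta_crossbar xi_crossbar)
  have "R' \<in> rects D" "S' \<in> rects D" using W i by auto
  with h i have "c = d" "on_vertical a R'" "on_vertical a S'" "meets R' S'"
    unfolding e using on_horizontal_ver[OF D] meets_ver_ver[OF D] by blast+
  with W i show "R = S" unfolding vertically_independent_def e by blast
qed

lemma card_lex:
  assumes D: "well_drawn D" and "A \<subseteq> set (xi D)" "B \<subseteq> set (eta D)"
  shows "card ((\<lambda>(a, b). scale D * a + b) ` (A \<times> B)) = card A * card B"
  using inj_on_subset[OF inj_lex[OF D], of "A \<times> B"] assms
  by (simp add: card_image card_cartesian_product Sigma_mono)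

text \<open>Horizontal copies keep the fraction of vertical lines that miss the family, since these lines see
  only the coarse digit.\<close>

lemma filler_rows:
  assumes D: "well_drawn D" and Z: "filler D Z"
  shows "filler (crossbar D) (rows D (set (xi D)) Z)"
proof -
  have Z': "Z \<subseteq> rects D" using Z by (simp add: filler_def)
  have ne: "set (xi D) \<noteq> {}" and q: "card (set (eta D)) = card (set (xi D))"
    using D by (auto simp: well_drawn_def)
  have "missed_verticals (crossbar D) (rows D (set (xi D)) Z)
      = (\<lambda>(a, b). scale D * a + b) ` (missed_verticals D Z \<times> set (eta D))"
    using Z' ne unfolding missed_verticals_def rows_def xi_crossbar
    by (auto simp: on_vertical_hor[OF D] subset_iff)
  then have "card (missed_verticals (crossbar D) (rows D (set (xi D)) Z))
      = card (missed_verticals D Z) * card (set (eta D))"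
    using card_lex[OF D] by (simp add: missed_verticals_def)
  then show ?thesis
    using Z rows_columns_subset(1)[OF order_refl Z'] triangle_free_rows[OF D order_refl Z']
      horizontally_independent_rows[OF D Z']
    by (auto simp: filler_def card_rows[OF D] card_xi_crossbar[OF D] q)
qed

definition pentagon :: "rect set" where
  "pentagon = {Rect 0 8 2 10, Rect 6 16 8 14, Rect 14 24 8 14, Rect 22 30 2 12, Rect 6 24 0 4}"

text \<open>In the base drawing the horizontal lines at 21 and 27 miss the five-cycle, while those at 3 and 11 hit
  it, even in intersecting pairs. The vertical lines hit it in disjoint members only. Vertical copies
  exchange the two directions, and so produce what a filler requires.\<close>

lemma filler_pentagon: "filler (crossbar base) (columns base (set (xi base)) pentagon)"
proof -
  have p: "pentagon \<subseteq> rects base" by (auto simp: pentagon_def base_def)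
  have tf: "triangle_free pentagon" by (simp add: triangle_free_def pentagon_def meets_Rect)
  have vi: "vertically_independent base pentagon"
    by (simp add: vertically_independent_def pentagon_def meets_Rect base_def)
  have "missed_verticals (crossbar base) (columns base (set (xi base)) pentagon)
      = (\<lambda>(a, b). scale base * a + b) ` (set (xi base) \<times> {b \<in> set (eta base). \<forall>R\<in>pentagon. \<not> on_horizontal b R})"
    using p unfolding missed_verticals_def columns_def xi_crossbar
    by (auto simp: on_vertical_ver[OF well_drawn_base] subset_iff)
  then have "card (missed_verticals (crossbar base) (columns base (set (xi base)) pentagon))
      = card (set (xi base)) * card {b \<in> set (eta base). \<forall>R\<in>pentagon. \<not> on_horizontal b R}"
    using card_lex[OF well_drawn_base] by simp
  moreover have "{b \<in> set (eta base). \<forall>R\<in>pentagon. \<not> on_horizontal b R} = {21, 27}"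
    by (auto simp: base_def pentagon_def)
  moreover have "card (set (xi base)) = 4" "card (set (eta base)) = 4" "card pentagon = 5"
    by (simp_all add: base_def pentagon_def)
  ultimately show ?thesis
    using rows_columns_subset(2)[OF order_refl p] triangle_free_columns[OF well_drawn_base order_refl p tf]
      horizontally_independent_columns[OF well_drawn_base p vi]
    by (simp add: filler_def card_columns[OF well_drawn_base _ p] card_xi_crossbar[OF well_drawn_base])
qed

lemma filler_exists: "\<exists>Z. filler (drawing_P (Suc n)) Z"
proof (induction n)
  case 0
  show ?case using filler_pentagon by auto
next
  case (Suc n)
  then show ?case using filler_rows[OF well_drawn_P, of "Suc n"] by auto
qed

definition core :: "drawing \<Rightarrow> rect set \<Rightarrow> bool" where
  "core D W \<longleftrightarrow> W \<subseteq> rects D \<and> triangle_free W \<and> vertically_independent D W"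

text \<open>The vertical copy at any marker of a rectangle in \<open>Z\<close> is met by a horizontal copy at \<open>a\<close> only if the line
  \<open>a\<close> hits that rectangle, which the choice of \<open>a\<close> excludes. So the two parts are unrelated, and each
  inherits what is required from \<open>W\<close> and \<open>Z\<close>.\<close>

lemma core_extend:
  assumes D: "well_drawn D" and W: "core D W" and Z: "filler D Z"
  defines "W' \<equiv> rows D (missed_verticals D Z) W \<union> columns D (set (xi D)) Z"
  shows "core (crossbar D) W'"
    and "4 * card W' = card (set (xi D)) * (2 * card W + 5 * card (set (xi D)))"
proof -
  let ?G = "missed_verticals D Z"
  have sub: "W \<subseteq> rects D" "Z \<subseteq> rects D" "?G \<subseteq> set (xi D)"
    using W Z by (auto simp: core_def filler_def missed_verticals_def)
  have "4 * card W' = 2 * (2 * card ?G) * card W + card (set (xi D)) * (4 * card Z)"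
    unfolding W'_def using card_rows_Un_columns[OF D sub(3,1) order_refl sub(2)] by simp
  with Z show "4 * card W' = card (set (xi D)) * (2 * card W + 5 * card (set (xi D)))"
    by (simp add: filler_def algebra_simps)
  have no_edge: "\<not> meets (hor (scale D) a R) (ver (scale D) c S)"
    if "a \<in> ?G" "R \<in> W" "c \<in> set (xi D)" "S \<in> Z" for a R c S
    using that sub meets_hor_ver[OF D, of R S a c] by (auto simp: missed_verticals_def)
  then have apart: "\<not> meets R S" if "R \<in> rows D ?G W" "S \<in> columns D (set (xi D)) Z" for R S
    using that unfolding rows_def columns_def by blast
  have "triangle_free (rows D ?G W)" "triangle_free (columns D (set (xi D)) Z)"
    using W Z sub triangle_free_rows[OF D] triangle_free_columns[OF D] by (auto simp: core_def filler_def)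
  then have "triangle_free W'"
    unfolding W'_def using apart meets_sym by (intro triangle_free_UnI) blast+
  moreover have "vertically_independent (crossbar D) W'"
    unfolding vertically_independent_def
  proof (intro ballI impI)
    fix p R S assume p: "p \<in> set (xi (crossbar D))" and RS: "R \<in> W'" "S \<in> W'"
      and h: "on_vertical p R \<and> on_vertical p S \<and> meets R S"
    obtain a b where e: "p = scale D * a + b" and ab: "a \<in> set (xi D)" "b \<in> set (eta D)"
      using p by (auto simp: xi_crossbar)
    consider "R \<in> rows D ?G W" "S \<in> rows D ?G W"
      | "R \<in> columns D (set (xi D)) Z" "S \<in> columns D (set (xi D)) Z"
      using RS h apart meets_sym unfolding W'_def by blast
    then show "R = S"
    proof cases
      case 1
      then obtain c d R' S' where f: "R = hor (scale D) c R'" "S = hor (scale D) d S'"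
        and i: "c \<in> ?G" "d \<in> ?G" "R' \<in> W" "S' \<in> W"
        by (auto simp: rows_def)
      have "R' \<in> rects D" "S' \<in> rects D" "c \<in> set (xi D)" "d \<in> set (xi D)"
        using i sub by auto
      with h ab have "c = d" "on_vertical a R'" "on_vertical a S'" "meets R' S'"
        by (auto simp: e f on_vertical_hor[OF D] meets_hor_hor[OF D])
      with W ab i show ?thesis unfolding core_def vertically_independent_def f by blast
    next
      case 2
      then obtain c d R' S' where f: "R = ver (scale D) c R'" "S = ver (scale D) d S'"
        and i: "c \<in> set (xi D)" "d \<in> set (xi D)" "R' \<in> Z" "S' \<in> Z"
        by (auto simp: columns_def)
      have "R' \<in> rects D" "S' \<in> rects D" using i sub by auto
      with h ab i have "c = d" "on_horizontal b R'" "on_horizontal b S'" "meets R' S'"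
        by (auto simp: e f on_vertical_ver[OF D] meets_ver_ver[OF D])
      with Z ab i show ?thesis unfolding filler_def horizontally_independent_def f by blast
    qed
  qed
  ultimately show "core (crossbar D) W'"
    using rows_columns_subset[OF sub(3,1)] rows_columns_subset[OF order_refl sub(2)]
    by (auto simp: core_def W'_def)
qed

text \<open>The density \<open>w = 5/2 - 5/2 / 2\<^sup>n\<close> is the solution of \<open>w' = 5/4 + w/2\<close> that starts at 0.\<close>

lemma core_exists:
  "\<exists>W. core (drawing_P (Suc n)) W \<and>
     real (card W) = (5 / 2 - 5 / 2 / 2 ^ n) * real (card (set (xi (drawing_P (Suc n)))))"
proof (induction n)
  case 0
  show ?case
    by (intro exI[of _ "{}"]) (simp add: core_def triangle_free_def vertically_independent_def)
next
  case (Suc n)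
  let ?D = "drawing_P (Suc n)"
  let ?q = "real (card (set (xi ?D)))"
  obtain W where W: "core ?D W" "real (card W) = (5 / 2 - 5 / 2 / 2 ^ n) * ?q"
    using Suc by blast
  obtain Z where Z: "filler ?D Z" using filler_exists by blast
  define W' where "W' = rows ?D (missed_verticals ?D Z) W \<union> columns ?D (set (xi ?D)) Z"
  have core: "core (drawing_P (Suc (Suc n))) W'"
    using core_extend(1)[OF well_drawn_P W(1) Z] by (simp add: W'_def)
  have q: "card (set (eta ?D)) = card (set (xi ?D))"
    using well_drawn_P[of "Suc n"] by (auto simp: well_drawn_def)
  have "real (card (set (xi (drawing_P (Suc (Suc n)))))) = ?q * ?q"
    using card_xi_crossbar[OF well_drawn_P[of "Suc n"]] q by simp
  moreover have "4 * card W' = card (set (xi ?D)) * (2 * card W + 5 * card (set (xi ?D)))"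
    using core_extend(2)[OF well_drawn_P W(1) Z] by (simp add: W'_def)
  then have "real (4 * card W') = real (card (set (xi ?D)) * (2 * card W + 5 * card (set (xi ?D))))"
    by (rule arg_cong)
  then have "4 * real (card W') = ?q * (2 * real (card W) + 5 * ?q)" by simp
  ultimately show ?case
    using core W(2) by (intro exI[of _ W']) (simp add: field_simps)
qed

text \<open>A triangle with members of both directions has two members in the same copy that cross a common copy of
  the other direction. Their originals then lie on a common vertical marker line and meet, which a core
  does not allow.\<close>

lemma triangle_free_crossbar:
  assumes D: "well_drawn D" and W: "core D W"
  shows "triangle_free (rows D (set (xi D)) W \<union> columns D (set (xi D)) W)"
proof -
  let ?X = "set (xi D)"
  have sub: "W \<subseteq> rects D" and vi: "vertically_independent D W" and tf: "triangle_free W"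
    using W by (auto simp: core_def)
  have rrc: "R = S" if RST: "R \<in> rows D ?X W" "S \<in> rows D ?X W" "T \<in> columns D ?X W"
    and m: "meets R S" "meets R T" "meets S T" for R S T
  proof -
    obtain a b c R' S' T' where e: "R = hor (scale D) a R'" "S = hor (scale D) b S'" "T = ver (scale D) c T'"
      and i: "a \<in> ?X" "b \<in> ?X" "c \<in> ?X" "R' \<in> W" "S' \<in> W" "T' \<in> W"
      using RST unfolding rows_def columns_def by blast
    have "R' \<in> rects D" "S' \<in> rects D" "T' \<in> rects D" using i sub by auto
    with m i have "a = b" "on_vertical c R'" "on_vertical c S'" "meets R' S'"
      by (auto simp: e meets_hor_hor[OF D] meets_hor_ver[OF D])
    with vi i show "R = S" unfolding vertically_independent_def e by blast
  qed
  have ccr: "R = S" if RST: "R \<in> columns D ?X W" "S \<in> columns D ?X W" "T \<in> rows D ?X W"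
    and m: "meets R S" "meets R T" "meets S T" for R S T
  proof -
    obtain a b c R' S' T' where e: "R = ver (scale D) a R'" "S = ver (scale D) b S'" "T = hor (scale D) c T'"
      and i: "a \<in> ?X" "b \<in> ?X" "c \<in> ?X" "R' \<in> W" "S' \<in> W" "T' \<in> W"
      using RST unfolding rows_def columns_def by blast
    have "R' \<in> rects D" "S' \<in> rects D" "T' \<in> rects D" using i sub by auto
    with m i have "a = b" "on_vertical c R'" "on_vertical c S'" "meets R' S'"
      by (auto simp: e meets_ver_ver[OF D] meets_hor_ver[OF D] meets_sym[of _ "hor _ _ _"])
    with vi i show "R = S" unfolding vertically_independent_def e by blast
  qed
  show ?thesis
    using triangle_free_rows[OF D order_refl sub tf] triangle_free_columns[OF D order_refl sub tf] rrc ccr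
    by (rule triangle_free_UnI)
qed

text \<open>A clique contains at most two members of a triangle-free subfamily, so weight \<open>1/2\<close> on each of them is
  feasible. The supremum is bounded because singletons are cliques.\<close>

lemma half_card_le_alpha_star:
  assumes "finite F" "W \<subseteq> F" "triangle_free W"
  shows "real (card W) / 2 \<le> alpha_star F"
proof -
  let ?G = "intersection_graph F"
  define x where "x R = (if R \<in> W then 1 / 2 else 0 :: real)" for R
  have vertices: "fst ?G = F" by (simp add: intersection_graph_def)
  have clique_meets: "meets R S" if "clique ?G K" "R \<in> K" "S \<in> K" "R \<noteq> S" for K R S
  proof -
    have "{R, S} \<in> snd ?G" using that unfolding clique_def by blast
    then obtain A B where "{R, S} = {A, B}" "meets A B"
      unfolding intersection_graph_def meets_def snd_conv by blast
    then show ?thesis using meets_sym[of A B] by (auto simp: doubleton_eq_iff)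
  qed
  have "(\<Sum>R\<in>K. x R) \<le> 1" if K: "clique ?G K" for K
  proof -
    have fin: "finite K" using K assms(1) by (auto simp: clique_def vertices intro: finite_subset)
    have "\<not> 3 \<le> card (K \<inter> W)"
    proof
      assume "3 \<le> card (K \<inter> W)"
      then obtain B where B: "B \<subseteq> K \<inter> W" "card B = 3"
        by (rule obtain_subset_with_card_n)
      then obtain R S T where "B = {R, S, T}" "R \<noteq> S" "S \<noteq> T" "R \<noteq> T"
        by (auto simp: card_3_iff)
      then have i: "R \<in> K" "S \<in> K" "T \<in> K" "R \<in> W" "S \<in> W" "T \<in> W"
        and d: "R \<noteq> S" "S \<noteq> T" "R \<noteq> T"
        using B by auto
      then have "meets R S \<and> meets S T \<and> meets R T"
        using clique_meets[OF K] by simp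
      with i d assms(3) show False
        unfolding triangle_free_def by metis
    qed
    moreover have "(\<Sum>R\<in>K. x R) = real (card (K \<inter> W)) / 2"
      using fin by (simp add: x_def sum.If_cases)
    ultimately show ?thesis by simp
  qed
  then have "clique_feasible ?G x" by (auto simp: clique_feasible_def x_def)
  moreover have "(\<Sum>R\<in>fst ?G. x R) = real (card W) / 2"
    using assms by (simp add: vertices x_def sum.If_cases Int_absorb1)
  ultimately have "real (card W) / 2 \<in> {(\<Sum>R\<in>fst ?G. x R) | x. clique_feasible ?G x}"
    by (intro CollectI exI[of _ x]) simp
  moreover have "bdd_above {(\<Sum>R\<in>fst ?G. x R) | x. clique_feasible ?G x}"
  proof (rule bdd_aboveI)
    fix s assume "s \<in> {(\<Sum>R\<in>fst ?G. x R) | x. clique_feasible ?G x}"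
    then obtain y where s: "s = (\<Sum>R\<in>F. y R)" and y: "clique_feasible ?G y" by (auto simp: vertices)
    have "y R \<le> 1" if "R \<in> F" for R
    proof -
      have "clique ?G {R}" using that by (simp add: clique_def vertices)
      with y have "(\<Sum>S\<in>{R}. y S) \<le> 1" unfolding clique_feasible_def by blast
      then show ?thesis by simp
    qed
    then show "s \<le> real (card F)" unfolding s using sum_bounded_above[of F y 1] by simp
  qed
  ultimately show ?thesis
    unfolding alpha_star_def graph_alpha_star_def by (rule cSup_upper)
qed

section \<open>The ratio\<close>

lemma alpha_star_nu_ratio:
  assumes "1 \<le> r"
  shows "5 / 2 - 5 / 2 ^ r \<le> alpha_star (P (r + 1)) / real (\<nu> (P (r + 1)))"
proof -
  obtain n where r: "r = Suc n" using assms by (cases r) auto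
  let ?D = "drawing_P r" and ?k = "5 / 2 - 5 / 2 ^ r :: real"
  let ?q = "card (set (xi ?D))"
  have D: "well_drawn ?D" by (rule well_drawn_P)
  obtain W where W: "core ?D W" "real (card W) = ?k * real ?q"
    using core_exists[of n] by (auto simp: r)
  let ?U = "rows ?D (set (xi ?D)) W \<union> columns ?D (set (xi ?D)) W"
  have sub: "W \<subseteq> rects ?D" using W by (simp add: core_def)
  have "?U \<subseteq> P (r + 1)"
    using rows_columns_subset[OF order_refl sub] by (simp add: P_def)
  then have "real (card ?U) / 2 \<le> alpha_star (P (r + 1))"
    using well_drawn_finite[OF well_drawn_P[of "r + 1"]] triangle_free_crossbar[OF D W(1)]
    by (intro half_card_le_alpha_star) (auto simp: P_def)
  moreover have "card (set (xi (drawing_P (r + 1)))) = ?q * ?q"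
    using D card_xi_crossbar[OF D] by (simp add: well_drawn_def)
  then have "?k * real (card (set (xi (drawing_P (r + 1))))) = real (card ?U) / 2"
    using card_rows_Un_columns[OF D order_refl sub order_refl sub] W(2) by simp
  ultimately have alpha: "?k * real (card (set (xi (drawing_P (r + 1))))) \<le> alpha_star (P (r + 1))"
    by simp
  have "(2::real) ^ 1 \<le> 2 ^ r" using assms by (intro power_increasing) auto
  then have "0 \<le> ?k" by (simp add: field_simps)
  then have "?k * real (\<nu> (P (r + 1))) \<le> ?k * real (card (set (xi (drawing_P (r + 1)))))"
    using nu_P_le[of "r + 1"] by (intro mult_left_mono) auto
  with alpha nu_P_pos[of "r + 1"] show ?thesis
    by (simp add: pos_le_divide_eq)
qed

theorem proposition19:
  "(\<forall>r::nat. r \<ge> 1 \<longrightarrow>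
      alpha_star (P (r + 1)) / real (\<nu> (P (r + 1)))
        \<ge> 5 / 2 - (30 * real r + 55 + 5 * (-1) ^ r) / 2 ^ (r + 4))
   \<and> liminf (\<lambda>r. ereal (alpha_star (P r) / real (\<nu> (P r)))) \<ge> ereal (5 / 2)"
proof (intro conjI allI impI)
  fix r :: nat assume r: "1 \<le> r"
  \<comment> \<open>\<open>5 / 2\<^sup>r = 80 / 2\<^bsup>r+4\<^esup>\<close>, with equality of the two error terms at \<open>r = 1\<close>.\<close>
  have "80 \<le> 30 * real r + 55 + 5 * (-1) ^ r"
  proof (cases "r = 1")
    case False
    with r show ?thesis by (cases "even r") auto
  qed simp
  then have "80 / 2 ^ (r + 4) \<le> (30 * real r + 55 + 5 * (-1) ^ r) / 2 ^ (r + 4)"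
    by (intro divide_right_mono) auto
  moreover have "80 / 2 ^ (r + 4) = 5 / (2 ^ r :: real)" by (simp add: power_add)
  ultimately show "5 / 2 - (30 * real r + 55 + 5 * (-1) ^ r) / 2 ^ (r + 4)
      \<le> alpha_star (P (r + 1)) / real (\<nu> (P (r + 1)))"
    using alpha_star_nu_ratio[OF r] by linarith
next
  let ?f = "\<lambda>r. alpha_star (P r) / real (\<nu> (P r))" and ?g = "\<lambda>r::nat. 5 / 2 - 10 * (1 / 2) ^ r :: real"
  have "?g \<longlonglongrightarrow> 5 / 2 - 10 * 0"
    by (intro tendsto_intros LIMSEQ_realpow_zero) auto
  then have "(\<lambda>r. ereal (?g r)) \<longlonglongrightarrow> ereal (5 / 2)" by simp
  then have "ereal (5 / 2) = liminf (\<lambda>r. ereal (?g r))"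
    by (rule lim_imp_Liminf[OF sequentially_bot, symmetric])
  also have "\<dots> \<le> liminf (\<lambda>r. ereal (?f r))"
  proof (rule Liminf_mono)
    have "?g r \<le> ?f r" if "2 \<le> r" for r
      using alpha_star_nu_ratio[of "r - 1"] that by (cases r) (auto simp: power_one_over)
    then show "\<forall>\<^sub>F r in sequentially. ereal (?g r) \<le> ereal (?f r)"
      by (auto simp: eventually_sequentially)
  qed
  finally show "ereal (5 / 2) \<le> liminf (\<lambda>r. ereal (?f r))" .
qed

end
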